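(* Let $b,c,\nu,\rho\in\mathbb{C}$ with $\operatorname{Re}(\nu)>-1$ and $\operatorname{Re}(\rho)>0$. For $z\in\mathbb{C}\setminus(-\infty,0]$, $$(2-\nu)\frac{\partial}{\partial z}G_{\nu-1}^{(b,c-1)}(z;\rho)+z\Big(\frac{\partial^2}{\partial z^2}G_{\nu-1}^{(b,c-1)}(z;\rho)+b\,\frac{\partial^2}{\partial z^2}G_{\nu+1}^{(b,c-1)}(z;\rho)\Big)=-b(\nu+2)\frac{\partial}{\partial z}G_{\nu+1}^{(b,c-1)}(z;\rho).$$
   Context: For $\rho\in\mathbb{C}$ with $\operatorname{Re}(\rho)>0$ and $x\in\mathbb{C}$ put $\Gamma_\rho(x)=\int_0^\infty t^{x-1}e^{-t-\rho/t}\,dt$. The generalized Pochhammer symbol is $(\lambda;\rho)_\nu:=\Gamma_\rho(\lambda+\nu)/\Gamma(\lambda)$ for $\lambda,\nu\in\mathbb{C}$, where $1/\Gamma$ is read as an entire function (zero at $0,-1,-2,\dots$). The unified four parameter Bessel function is $$G_\nu^{(b,c)}(z;\rho):=\sum_{k=0}^\infty \frac{(-b)^k (c;\rho)_{2k+\nu}}{\Gamma(\nu+k+1)\,\Gamma(\nu+2k+1)}\,\frac{(z/2)^{2k+\nu}}{k!}.$$ Functions with shifted order $\nu\pm1$ are given by the same series. Complex powers are principal. *)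

theory Defs
  imports "HOL-Complex_Analysis.Complex_Analysis"
begin

text \<open>The integral converges absolutely for every complex \<open>x\<close> as soon as \<open>Re \<rho> > 0\<close>.\<close>

definition gen_Gamma :: "complex \<Rightarrow> complex \<Rightarrow> complex" where
  "gen_Gamma \<rho> x =
     (LBINT t:{0<..}. complex_of_real t powr (x - 1) *
        exp (- complex_of_real t - \<rho> / complex_of_real t))"

text \<open>All reciprocals of the Gamma function are written with \<^const>\<open>rGamma\<close>, the entire
  function \<open>1 / \<Gamma>\<close>, which vanishes at the nonpositive integers.\<close>

definition gen_poch :: "complex \<Rightarrow> complex \<Rightarrow> complex \<Rightarrow> complex" where
  "gen_poch a \<rho> \<nu> = gen_Gamma \<rho> (a + \<nu>) * rGamma a"

definition unified_Bessel ::
    "complex \<Rightarrow> complex \<Rightarrow> complex \<Rightarrow> complex \<Rightarrow> complex \<Rightarrow> complex" where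
  "unified_Bessel b c \<nu> \<rho> z =
     (\<Sum>k. (- b) ^ k * gen_poch c \<rho> (2 * of_nat k + \<nu>) *
        rGamma (\<nu> + of_nat k + 1) * rGamma (\<nu> + 2 * of_nat k + 1) *
        ((z / 2) powr (2 * of_nat k + \<nu>) / fact k))"

end

theory Submission
  imports Defs "HOL-Real_Asymp.Real_Asymp"
begin

text \<open>
  Write \<open>A\<close> and \<open>B\<close> for the functions of orders \<open>\<nu> - 1\<close> and \<open>\<nu> + 1\<close>. The identity says that
  \<open>(2 - \<nu>) A' + z A'' = - b ((\<nu> + 2) B' + z B'')\<close>, and it holds coefficient by coefficient.
  On a single power the operator \<open>\<kappa> d/dz + z d\<^sup>2/dz\<^sup>2\<close> acts by
  \<open>(z/2)\<^sup>m \<mapsto> m (m - 1 + \<kappa>)/2 \<cdot> (z/2)\<^sup>m\<^sup>-\<^sup>1\<close>. For \<open>A\<close> the exponents are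
  \<open>m = 2k + \<nu> - 1\<close>, so with \<open>\<kappa> = 2 - \<nu>\<close> the second factor becomes \<open>2k\<close>, which kills the term
  \<open>k = 0\<close>; for \<open>B\<close> the exponents are \<open>m = 2k + \<nu> + 1\<close>, and with \<open>\<kappa> = \<nu> + 2\<close> it becomes
  \<open>2 (k + \<nu> + 1)\<close>. After shifting the index of the first series by one, both series run over
  the same powers, and their coefficients agree because orders differing by two are linked by
  the recurrence \<open>Bessel_coeff_contiguous\<close>, which is the functional equation of \<open>1/\<Gamma>\<close>. The
  generalized Pochhammer symbol has the same argument on both sides and never has to be evaluated.

  The analytic content is that the series may be differentiated twice term by term. Up to the
  factor \<open>(z/2)\<^sup>\<mu>\<close> the series of order \<open>\<mu>\<close> is a power series in \<open>(z/2)\<^sup>2\<close>, so it suffices that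
  this power series is entire (\<open>summable_Bessel_coeff\<close>). This in turn follows from
  \<open>\<bar>\<Gamma>\<^sub>\<rho>(x)\<bar> \<le> \<Gamma>(Re x)\<close> and the ratio test: \<open>\<Gamma>(2k + s)\<close> in the numerator is balanced
  by \<open>\<Gamma>(\<nu> + 2k + 1)\<close> in the denominator, and \<open>\<Gamma>(\<nu> + k + 1) k!\<close> remains to force convergence.
\<close>

section \<open>Growth of the coefficients\<close>

text \<open>
  On the positive axis \<open>\<bar>exp (- \<rho>/t)\<bar> \<le> 1\<close>, so the integrand is dominated by that of Euler's
  integral. Instead of proving integrability, the argument lets the integral take its default
  value zero otherwise, for which the bound holds because \<open>\<Gamma>(Re x)\<close> is positive.
\<close>

lemma norm_gen_Gamma_le_Gamma:
  assumes "Re \<rho> > 0" and "Re x > 0"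
  shows "norm (gen_Gamma \<rho> x) \<le> Gamma (Re x)"
proof -
  define f where "f = (\<lambda>t::real. indicator {0<..} t *\<^sub>R (complex_of_real t powr (x - 1) *
        exp (- complex_of_real t - \<rho> / complex_of_real t)))"
  have eq: "gen_Gamma \<rho> x = integral\<^sup>L lborel f"
    by (simp add: gen_Gamma_def f_def set_lebesgue_integral_def)
  show ?thesis
  proof (cases "integrable lborel f")
    case False
    then show ?thesis
      using assms by (simp add: eq not_integrable_integral_eq less_imp_le)
  next
    case True
    have pt: "norm (f t) \<le> indicator {0..} t * t powr (Re x - 1) / exp t" for t
    proof (cases "t > 0")
      case True
      then have "exp (- t - Re \<rho> / t) \<le> exp (- t)"
        using assms by simp
      then have "t powr (Re x - 1) * exp (- t - Re \<rho> / t) \<le> t powr (Re x - 1) * exp (- t)"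
        by (intro mult_left_mono) auto
      moreover have "Re (\<rho> / complex_of_real t) = Re \<rho> / t"
        by (rule Re_divide_of_real)
      moreover have "norm (complex_of_real t powr (x - 1)) = t powr (Re x - 1)"
        using True by (subst norm_powr_real_powr) auto
      ultimately show ?thesis
        using True by (simp add: f_def norm_mult exp_minus field_simps)
    qed (simp add: f_def)
    have "ennreal (norm (integral\<^sup>L lborel f)) \<le> (\<integral>\<^sup>+ t. ennreal (norm (f t)) \<partial>lborel)"
      using True by (rule integral_norm_bound_ennreal)
    also have "\<dots> \<le> (\<integral>\<^sup>+ t. ennreal (indicator {0..} t * t powr (Re x - 1) / exp t) \<partial>lborel)"
      by (intro nn_integral_mono ennreal_leI pt)
    also have "\<dots> = ennreal (Gamma (Re x))"
      using Gamma_conv_nn_integral_real[OF assms(2)] by simp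
    finally show ?thesis
      using assms(2) by (simp add: eq ennreal_le_iff less_imp_le)
  qed
qed

definition Bessel_coeff :: "complex \<Rightarrow> complex \<Rightarrow> complex \<Rightarrow> complex \<Rightarrow> nat \<Rightarrow> complex" where
  "Bessel_coeff b c \<nu> \<rho> k = (- b) ^ k * gen_poch c \<rho> (2 * of_nat k + \<nu>) *
     rGamma (\<nu> + of_nat k + 1) * rGamma (\<nu> + 2 * of_nat k + 1) / fact k"

lemma norm_rGamma_plus1_le:
  fixes z :: complex
  assumes "Re z > 0"
  shows "norm (rGamma (z + 1)) \<le> norm (rGamma z) / Re z"
proof -
  have "Re z * norm (rGamma (z + 1)) \<le> norm z * norm (rGamma (z + 1))"
    by (intro mult_right_mono complex_Re_le_cmod) auto
  also have "\<dots> = norm (rGamma z)"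
    by (metis norm_mult rGamma_plus1)
  finally show ?thesis
    using assms by (simp add: field_simps)
qed

text \<open>
  The coefficients are majorized by a sequence \<open>u\<close> of ordinary Gamma quotients, whose consecutive
  ratio is at most a rational function \<open>q\<close> of \<open>k\<close> with numerator of degree two and denominator of
  degree four. Since \<open>q\<close> tends to zero for every radius, the power series is entire.
\<close>

lemma summable_Bessel_coeff:
  assumes "Re \<rho> > 0"
  shows "summable (\<lambda>k. Bessel_coeff b c \<nu> \<rho> k * w ^ k)"
proof -
  define s where "s = Re (c + \<nu>)"
  define n where "n = Re \<nu>"
  \<comment> \<open>The summand \<open>1\<close> makes \<open>r\<close> positive, also when \<open>b\<close> or \<open>w\<close> vanishes.\<close>
  define r where "r = norm b * norm w + 1"
  have r: "r > 0"
    by (simp add: r_def add_nonneg_pos)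
  define u where "u = (\<lambda>k::nat. r ^ k * Gamma (2 * real k + s) *
      norm (rGamma (\<nu> + of_nat k + 1)) * norm (rGamma (\<nu> + 2 * of_nat k + 1)) / fact k)"
  define q where "q = (\<lambda>k::nat. r * ((2 * real k + s) * (2 * real k + s + 1)) /
      ((real k + n + 1) * (2 * real k + n + 1) * (2 * real k + n + 2) * (real k + 1)))"
  have "q \<longlonglongrightarrow> 0"
    using r unfolding q_def by real_asymp
  then have ev1: "eventually (\<lambda>k. q k < 1 / 2) sequentially"
    by (rule order_tendstoD) simp
  \<comment> \<open>For indices beyond this point all Gamma arguments have positive real part, away from the poles.\<close>
  have ev2: "eventually (\<lambda>k. real k + s > 0 \<and> real k + n > 0) sequentially"
    by (intro eventually_conj; real_asymp)
  obtain N where N: "\<And>k. k \<ge> N \<Longrightarrow> q k < 1 / 2 \<and> real k + s > 0 \<and> real k + n > 0"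
    using eventually_conj[OF ev1 ev2] by (auto simp: eventually_sequentially)
  have u_nonneg: "u k \<ge> 0" if "k \<ge> N" for k
    using N[OF that] r by (auto simp: u_def intro!: mult_nonneg_nonneg divide_nonneg_pos less_imp_le)
  have "norm (u (Suc k)) \<le> 1 / 2 * norm (u k)" if k: "k \<ge> N" for k
  proof -
    note Nk = N[OF k]
    have G: "Gamma (2 * real (Suc k) + s) =
        (2 * real k + s + 1) * ((2 * real k + s) * Gamma (2 * real k + s))"
    proof -
      have "Gamma (2 * real k + s + 1) = (2 * real k + s) * Gamma (2 * real k + s)"
        using Nk by (intro Gamma_plus1) (auto elim!: nonpos_Ints_cases)
      moreover have "Gamma (2 * real k + s + 1 + 1) = (2 * real k + s + 1) * Gamma (2 * real k + s + 1)"
        using Nk by (intro Gamma_plus1) (auto elim!: nonpos_Ints_cases)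
      moreover have "2 * real (Suc k) + s = 2 * real k + s + 1 + 1"
        by simp
      ultimately show ?thesis by (simp only:)
    qed
    have R1: "norm (rGamma (\<nu> + of_nat (Suc k) + 1))
        \<le> norm (rGamma (\<nu> + of_nat k + 1)) / (real k + n + 1)"
      using norm_rGamma_plus1_le[of "\<nu> + of_nat k + 1"] Nk by (simp add: n_def algebra_simps)
    have "norm (rGamma (\<nu> + 2 * of_nat k + 2 + 1))
        \<le> norm (rGamma (\<nu> + 2 * of_nat k + 2)) / (2 * real k + n + 2)"
      using norm_rGamma_plus1_le[of "\<nu> + 2 * of_nat k + 2"] Nk by (simp add: n_def algebra_simps)
    also have "\<dots> \<le> norm (rGamma (\<nu> + 2 * of_nat k + 1)) / (2 * real k + n + 1) / (2 * real k + n + 2)"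
      using norm_rGamma_plus1_le[of "\<nu> + 2 * of_nat k + 1"] Nk
      by (intro divide_right_mono) (simp_all add: n_def algebra_simps)
    finally have R2: "norm (rGamma (\<nu> + 2 * of_nat (Suc k) + 1))
        \<le> norm (rGamma (\<nu> + 2 * of_nat k + 1)) / (2 * real k + n + 1) / (2 * real k + n + 2)"
      by (simp add: algebra_simps)
    have "u (Suc k) \<le> r ^ Suc k * Gamma (2 * real (Suc k) + s) *
        (norm (rGamma (\<nu> + of_nat k + 1)) / (real k + n + 1)) *
        (norm (rGamma (\<nu> + 2 * of_nat k + 1)) / (2 * real k + n + 1) / (2 * real k + n + 2)) /
        fact (Suc k)"
      unfolding u_def using Nk r
      by (intro divide_right_mono mult_mono R1 R2 mult_nonneg_nonneg order.refl)
         (auto intro!: less_imp_le Gamma_real_pos divide_nonneg_pos)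
    also have "\<dots> = q k * u k"
      unfolding G using Nk by (simp add: u_def q_def divide_simps)
    also have "\<dots> \<le> 1 / 2 * u k"
      using Nk u_nonneg[OF k] by (intro mult_right_mono) auto
    finally show ?thesis
      using u_nonneg[OF k] u_nonneg[of "Suc k"] k by simp
  qed
  then have "summable u"
    by (rule summable_ratio_test[rotated]) auto
  then have "summable (\<lambda>k. norm (rGamma c) * u k)"
    by (rule summable_mult)
  moreover have "norm (Bessel_coeff b c \<nu> \<rho> k * w ^ k) \<le> norm (rGamma c) * u k" if k: "k \<ge> N" for k
  proof -
    have "norm (gen_Gamma \<rho> (c + (2 * of_nat k + \<nu>))) \<le> Gamma (2 * real k + s)"
      using norm_gen_Gamma_le_Gamma[OF assms, of "c + (2 * of_nat k + \<nu>)"] N[OF k]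
      by (simp add: s_def algebra_simps)
    moreover have "(norm b * norm w) ^ k \<le> r ^ k"
      by (intro power_mono) (auto simp: r_def)
    ultimately have *: "(norm b * norm w) ^ k * norm (gen_Gamma \<rho> (c + (2 * of_nat k + \<nu>)))
        \<le> r ^ k * Gamma (2 * real k + s)"
      using r by (intro mult_mono) auto
    have "norm (Bessel_coeff b c \<nu> \<rho> k * w ^ k) =
        ((norm b * norm w) ^ k * norm (gen_Gamma \<rho> (c + (2 * of_nat k + \<nu>)))) *
        (norm (rGamma c) * norm (rGamma (\<nu> + of_nat k + 1)) *
         norm (rGamma (\<nu> + 2 * of_nat k + 1)) / fact k)"
      by (simp add: Bessel_coeff_def gen_poch_def norm_mult norm_divide norm_power
            power_mult_distrib field_simps)
    also have "\<dots> \<le> (r ^ k * Gamma (2 * real k + s)) *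
        (norm (rGamma c) * norm (rGamma (\<nu> + of_nat k + 1)) *
         norm (rGamma (\<nu> + 2 * of_nat k + 1)) / fact k)"
      by (intro mult_right_mono *) auto
    finally show ?thesis
      by (simp add: u_def mult_ac)
  qed
  ultimately show ?thesis
    by (rule summable_comparison_test')
qed

section \<open>Termwise differentiation\<close>

text \<open>
  Series of this shape, with coefficients of an entire power series, are closed under
  differentiation: the order drops by one and the coefficients pick up a linear factor.
\<close>

definition half_powr_series :: "(nat \<Rightarrow> complex) \<Rightarrow> complex \<Rightarrow> complex \<Rightarrow> complex" where
  "half_powr_series a \<mu> z = (\<Sum>k. a k * (z / 2) powr (2 * of_nat k + \<mu>))"

lemma unified_Bessel_eq_half_powr_series:
  "unified_Bessel b c \<nu> \<rho> = half_powr_series (Bessel_coeff b c \<nu> \<rho>) \<nu>"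
  by (rule ext) (simp add: unified_Bessel_def half_powr_series_def Bessel_coeff_def)

lemma powr_double_plus:
  fixes x :: complex
  assumes "x \<noteq> 0"
  shows "x powr (2 * of_nat k + \<mu>) = x powr \<mu> * (x\<^sup>2) ^ k"
  using assms powr_nat'[of x "2 * k"] by (simp add: powr_add power_mult)

lemma half_powr_series_sums:
  assumes "\<And>w. summable (\<lambda>k. a k * w ^ k)" and "z \<noteq> 0"
  shows "(\<lambda>k. a k * (z / 2) powr (2 * of_nat k + \<mu>)) sums half_powr_series a \<mu> z"
proof -
  have "summable (\<lambda>k. (z / 2) powr \<mu> * (a k * ((z / 2)\<^sup>2) ^ k))"
    by (intro summable_mult assms)
  also have "(\<lambda>k. (z / 2) powr \<mu> * (a k * ((z / 2)\<^sup>2) ^ k)) =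
      (\<lambda>k. a k * (z / 2) powr (2 * of_nat k + \<mu>))"
    using assms(2) by (subst powr_double_plus) (auto simp: mult_ac)
  finally show ?thesis
    unfolding half_powr_series_def by (rule summable_sums)
qed

lemma summable_linear_times_coeff:
  fixes a :: "nat \<Rightarrow> complex"
  assumes "\<And>w. summable (\<lambda>k. a k * w ^ k)"
  shows "summable (\<lambda>k. a k * (2 * of_nat k + \<mu>) / 2 * w ^ k)"
proof -
  have "(\<lambda>k. of_nat k * a k * w ^ (k - Suc 0)) sums (\<Sum>k. diffs a k * w ^ k)"
    by (intro diffs_equiv termdiff_converges_all assms)
  then have "summable (\<lambda>k. w * (of_nat k * a k * w ^ (k - Suc 0)))"
    by (intro summable_mult) (rule sums_summable)
  also have "(\<lambda>k. w * (of_nat k * a k * w ^ (k - Suc 0))) = (\<lambda>k. of_nat k * a k * w ^ k)"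
  proof
    show "w * (of_nat k * a k * w ^ (k - Suc 0)) = of_nat k * a k * w ^ k" for k
      by (cases k) auto
  qed
  finally have "summable (\<lambda>k. of_nat k * a k * w ^ k + \<mu> / 2 * (a k * w ^ k))"
    by (intro summable_add summable_mult assms)
  then show ?thesis
    by (simp add: algebra_simps add_divide_distrib)
qed

text \<open>
  With \<open>w = (z/2)\<^sup>2\<close> the series is the product of \<open>(z/2)\<^sup>\<mu>\<close> and the power series \<open>S w\<close>. The product
  rule gives \<open>(z/2)\<^sup>\<mu>\<^sup>-\<^sup>1 (w S' w + \<mu>/2 \<cdot> S w)\<close>, and \<open>w S' w\<close> multiplies the \<open>k\<close>-th coefficient
  by \<open>k\<close>.
\<close>

lemma half_powr_series_has_derivative:
  assumes a: "\<And>w. summable (\<lambda>k. a k * w ^ k)" and z: "z \<notin> \<real>\<^sub>\<le>\<^sub>0"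
  shows "(half_powr_series a \<mu> has_field_derivative
           half_powr_series (\<lambda>k. a k * (2 * of_nat k + \<mu>) / 2) (\<mu> - 1) z) (at z)"
proof -
  define S where "S = (\<lambda>w. \<Sum>k. a k * w ^ k)"
  define w where "w = (z / 2)\<^sup>2"
  have z0: "z \<noteq> 0" and z2: "z / 2 \<notin> \<real>\<^sub>\<le>\<^sub>0"
    using z by (auto simp: complex_nonpos_Reals_iff)
  define D where "D = (\<Sum>k. diffs a k * w ^ k)"
  have dS: "(S has_field_derivative D) (at w)"
    unfolding S_def D_def by (rule termdiffs_strong_converges_everywhere[OF a])
  have factor: "half_powr_series a \<mu> x = (x / 2) powr \<mu> * S ((x / 2)\<^sup>2)" if "x \<noteq> 0" for x
  proof -
    have "(\<lambda>k. a k * (x / 2) powr (2 * of_nat k + \<mu>)) =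
        (\<lambda>k. (x / 2) powr \<mu> * (a k * ((x / 2)\<^sup>2) ^ k))"
      using that by (subst powr_double_plus) (auto simp: mult_ac)
    then show ?thesis
      by (simp only: half_powr_series_def S_def suminf_mult[OF a])
  qed
  have d2: "((\<lambda>x. S ((x / 2)\<^sup>2)) has_field_derivative D * (z / 2)) (at z)"
  proof (rule DERIV_chain'[where f = "\<lambda>x. (x / 2)\<^sup>2" and g = S])
    show "((\<lambda>x. (x / 2)\<^sup>2) has_field_derivative z / 2) (at z)"
      by (auto intro!: derivative_eq_intros)
  qed (use dS w_def in auto)
  have d1: "((\<lambda>x. (x / 2) powr \<mu>) has_field_derivative \<mu> / 2 * (z / 2) powr (\<mu> - 1)) (at z)"
    using z2 by (auto intro!: derivative_eq_intros)
  have "((\<lambda>x. (x / 2) powr \<mu> * S ((x / 2)\<^sup>2)) has_field_derivative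
      (z / 2) powr \<mu> * (D * (z / 2)) + \<mu> / 2 * (z / 2) powr (\<mu> - 1) * S w) (at z)"
    unfolding w_def by (rule DERIV_mult'[OF d1 d2])
  moreover have "(z / 2) powr \<mu> * (D * (z / 2)) + \<mu> / 2 * (z / 2) powr (\<mu> - 1) * S w =
      half_powr_series (\<lambda>k. a k * (2 * of_nat k + \<mu>) / 2) (\<mu> - 1) z" (is "?L = ?R")
  proof -
    have "(\<lambda>k. of_nat k * a k * w ^ (k - Suc 0)) sums D"
      unfolding D_def by (intro diffs_equiv termdiff_converges_all a)
    moreover have "(\<lambda>k. a k * w ^ k) sums S w"
      unfolding S_def by (rule summable_sums[OF a])
    ultimately have "(\<lambda>k. (z / 2) powr (\<mu> - 1) * (w * (of_nat k * a k * w ^ (k - Suc 0)) +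
        \<mu> / 2 * (a k * w ^ k))) sums ((z / 2) powr (\<mu> - 1) * (w * D + \<mu> / 2 * S w))"
      by (intro sums_mult sums_add)
    moreover have "(z / 2) powr (\<mu> - 1) * (w * (of_nat k * a k * w ^ (k - Suc 0)) +
        \<mu> / 2 * (a k * w ^ k)) =
        a k * (2 * of_nat k + \<mu>) / 2 * (z / 2) powr (2 * of_nat k + (\<mu> - 1))" for k
    proof -
      have e: "w * (of_nat k * a k * w ^ (k - Suc 0)) = of_nat k * a k * w ^ k"
        by (cases k) auto
      have "(z / 2) powr (2 * of_nat k + (\<mu> - 1)) = (z / 2) powr (\<mu> - 1) * w ^ k"
        using z0 unfolding w_def by (intro powr_double_plus) simp
      then show ?thesis
        unfolding e by (simp add: field_simps)
    qed
    ultimately have "?R = (z / 2) powr (\<mu> - 1) * (w * D + \<mu> / 2 * S w)"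
      unfolding half_powr_series_def by (simp only: sums_iff)
    moreover have "(z / 2) powr \<mu> = (z / 2) powr (\<mu> - 1) * (z / 2)"
      using z0 by (simp add: powr_diff)
    ultimately show ?thesis
      by (simp add: w_def algebra_simps power2_eq_square)
  qed
  ultimately have "((\<lambda>x. (x / 2) powr \<mu> * S ((x / 2)\<^sup>2)) has_field_derivative
      half_powr_series (\<lambda>k. a k * (2 * of_nat k + \<mu>) / 2) (\<mu> - 1) z) (at z)"
    by (simp only:)
  then show ?thesis
    by (rule has_field_derivative_transform_within_open[where S = "- {0}"])
       (use z0 factor in auto)
qed

text \<open>
  The operator \<open>\<kappa> d/dz + z d\<^sup>2/dz\<^sup>2\<close> is homogeneous of degree \<open>-1\<close>, so it sends each power of
  \<open>z/2\<close> to a multiple of a single power. Both sides of the differential identity are instances.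
\<close>

lemma half_powr_series_second_order_sums:
  fixes a :: "nat \<Rightarrow> complex" and \<kappa> \<mu> z :: complex
  assumes a: "\<And>w. summable (\<lambda>k. a k * w ^ k)" and z: "z \<notin> \<real>\<^sub>\<le>\<^sub>0"
  defines "f \<equiv> half_powr_series a \<mu>"
  shows "(\<lambda>k. a k * (2 * of_nat k + \<mu>) * (2 * of_nat k + \<mu> - 1 + \<kappa>) / 2 *
            (z / 2) powr (2 * of_nat k + \<mu> - 1))
         sums (\<kappa> * deriv f z + z * (deriv ^^ 2) f z)"
proof -
  define a' where "a' = (\<lambda>k. a k * (2 * of_nat k + \<mu>) / 2)"
  define a'' where "a'' = (\<lambda>k. a' k * (2 * of_nat k + (\<mu> - 1)) / 2)"
  have a': "summable (\<lambda>k. a' k * w ^ k)" for w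
    unfolding a'_def by (rule summable_linear_times_coeff[OF a])
  have a'': "summable (\<lambda>k. a'' k * w ^ k)" for w
    unfolding a''_def by (rule summable_linear_times_coeff[OF a'])
  have d1: "deriv f x = half_powr_series a' (\<mu> - 1) x" if "x \<notin> \<real>\<^sub>\<le>\<^sub>0" for x
    unfolding f_def a'_def by (rule DERIV_imp_deriv[OF half_powr_series_has_derivative[OF a that]])
  \<comment> \<open>For the second derivative the formula for the first one is needed on a neighbourhood.\<close>
  have "eventually (\<lambda>x. x \<in> - \<real>\<^sub>\<le>\<^sub>0) (nhds z)"
    using z by (intro eventually_nhds_in_open) (auto simp: open_Compl)
  then have "eventually (\<lambda>x. deriv f x = half_powr_series a' (\<mu> - 1) x) (nhds z)"
    by eventually_elim (simp add: d1)
  then have "deriv (deriv f) z = deriv (half_powr_series a' (\<mu> - 1)) z"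
    by (rule deriv_cong_ev) simp
  also have "\<dots> = half_powr_series a'' (\<mu> - 1 - 1) z"
    unfolding a''_def by (rule DERIV_imp_deriv[OF half_powr_series_has_derivative[OF a' z]])
  finally have d2: "(deriv ^^ 2) f z = half_powr_series a'' (\<mu> - 1 - 1) z"
    by (simp add: numeral_2_eq_2)
  have z0: "z \<noteq> 0"
    using z by auto
  have "(\<lambda>k. \<kappa> * (a' k * (z / 2) powr (2 * of_nat k + (\<mu> - 1))) +
             z * (a'' k * (z / 2) powr (2 * of_nat k + (\<mu> - 1 - 1))))
         sums (\<kappa> * deriv f z + z * (deriv ^^ 2) f z)"
    unfolding d1[OF z] d2
    by (intro sums_add sums_mult half_powr_series_sums a' a'' z0)
  moreover have "\<kappa> * (a' k * (z / 2) powr (2 * of_nat k + (\<mu> - 1))) +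
             z * (a'' k * (z / 2) powr (2 * of_nat k + (\<mu> - 1 - 1))) =
        a k * (2 * of_nat k + \<mu>) * (2 * of_nat k + \<mu> - 1 + \<kappa>) / 2 *
            (z / 2) powr (2 * of_nat k + \<mu> - 1)" for k
  proof -
    define m where "m = 2 * of_nat k + \<mu>"
    have m: "2 * of_nat k + (\<mu> - 1) = m - 1" "2 * of_nat k + (\<mu> - 1 - 1) = m - 1 - 1"
      by (simp_all add: m_def)
    have "z * (z / 2) powr (m - 1 - 1) = 2 * (z / 2) powr (m - 1)"
      using z0 powr_diff[of "z / 2" "m - 1" 1] by simp
    then have eq: "z * (a'' k * (z / 2) powr (m - 1 - 1)) = a'' k * (2 * (z / 2) powr (m - 1))"
      by (metis mult.left_commute)
    have "\<kappa> * (a' k * X) + a'' k * (2 * X) = a k * m * (m - 1 + \<kappa>) / 2 * X" for X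
      unfolding a''_def m unfolding a'_def m_def[symmetric] by (simp add: field_simps)
    then show ?thesis
      unfolding m unfolding m_def[symmetric] eq .
  qed
  ultimately show ?thesis
    by (simp only:)
qed

section \<open>The differential identity\<close>

text \<open>
  For order \<open>\<mu>\<close> the generalized Pochhammer symbol and the factor \<open>1/\<Gamma>(\<mu> + 2k + 1)\<close> depend on
  \<open>\<mu> + 2k\<close> only, so raising the index by one and raising the order by two have the same effect
  on them. The remaining factors \<open>1/k!\<close> and \<open>1/\<Gamma>(\<mu> + k + 1)\<close> then differ by one step of their
  functional equations.
\<close>

lemma Bessel_coeff_contiguous:
  "of_nat (Suc k) * Bessel_coeff b c (\<nu> - 1) \<rho> (Suc k) =
     - b * (\<nu> + of_nat k + 1) * Bessel_coeff b c (\<nu> + 1) \<rho> k"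
proof -
  define P where "P = (- b) ^ k * gen_poch c \<rho> (2 * of_nat k + (\<nu> + 1)) *
      rGamma (\<nu> + 2 * of_nat k + 2) / fact k"
  have "of_nat (Suc k) * Bessel_coeff b c (\<nu> - 1) \<rho> (Suc k) = - b * P * rGamma (\<nu> + of_nat k + 1)"
    by (simp add: Bessel_coeff_def P_def algebra_simps del: of_nat_Suc) (simp add: algebra_simps)
  moreover have "Bessel_coeff b c (\<nu> + 1) \<rho> k = P * rGamma (\<nu> + of_nat k + 1 + 1)"
    by (simp add: Bessel_coeff_def P_def algebra_simps)
  moreover have "rGamma (\<nu> + of_nat k + 1) = (\<nu> + of_nat k + 1) * rGamma (\<nu> + of_nat k + 1 + 1)"
    by (rule rGamma_plus1[symmetric])
  ultimately show ?thesis
    by (simp add: mult_ac)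
qed

theorem theorem3p4:
  fixes b c \<nu> \<rho> z :: complex
  assumes "Re \<nu> > -1" and "Re \<rho> > 0" and "z \<notin> \<real>\<^sub>\<le>\<^sub>0"
  shows "(2 - \<nu>) * deriv (unified_Bessel b (c - 1) (\<nu> - 1) \<rho>) z
         + z * ((deriv ^^ 2) (unified_Bessel b (c - 1) (\<nu> - 1) \<rho>) z
                + b * (deriv ^^ 2) (unified_Bessel b (c - 1) (\<nu> + 1) \<rho>) z)
       = - b * (\<nu> + 2) * deriv (unified_Bessel b (c - 1) (\<nu> + 1) \<rho>) z"
proof -
  define \<alpha> where "\<alpha> = Bessel_coeff b (c - 1) (\<nu> - 1) \<rho>"
  define \<beta> where "\<beta> = Bessel_coeff b (c - 1) (\<nu> + 1) \<rho>"
  define A where "A = unified_Bessel b (c - 1) (\<nu> - 1) \<rho>"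
  define B where "B = unified_Bessel b (c - 1) (\<nu> + 1) \<rho>"
  define L where "L = (2 - \<nu>) * deriv A z + z * (deriv ^^ 2) A z"
  define R where "R = (\<nu> + 2) * deriv B z + z * (deriv ^^ 2) B z"
  define p where "p = (\<lambda>k::nat. (z / 2) powr (2 * of_nat k + \<nu>))"
  have "(\<lambda>k. \<alpha> k * (2 * of_nat k + (\<nu> - 1)) * (2 * of_nat k + (\<nu> - 1) - 1 + (2 - \<nu>)) / 2 *
            (z / 2) powr (2 * of_nat k + (\<nu> - 1) - 1)) sums L"
    unfolding L_def A_def unified_Bessel_eq_half_powr_series \<alpha>_def
    by (rule half_powr_series_second_order_sums[OF summable_Bessel_coeff[OF assms(2)] assms(3)])
  \<comment> \<open>The term at index \<open>0\<close> vanishes, so the summation can start at \<open>1\<close>.\<close>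
  then have "(\<lambda>k. \<alpha> (Suc k) * (2 * of_nat (Suc k) + (\<nu> - 1)) *
            (2 * of_nat (Suc k) + (\<nu> - 1) - 1 + (2 - \<nu>)) / 2 *
            (z / 2) powr (2 * of_nat (Suc k) + (\<nu> - 1) - 1)) sums L"
    by (subst sums_Suc_iff) simp
  moreover have "\<alpha> (Suc k) * (2 * of_nat (Suc k) + (\<nu> - 1)) *
            (2 * of_nat (Suc k) + (\<nu> - 1) - 1 + (2 - \<nu>)) / 2 *
            (z / 2) powr (2 * of_nat (Suc k) + (\<nu> - 1) - 1) =
       of_nat (Suc k) * \<alpha> (Suc k) * (2 * of_nat k + \<nu> + 1) * p k" for k
  proof -
    have e: "2 * of_nat (Suc k) + (\<nu> - 1) = 2 * of_nat k + \<nu> + 1"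
      by simp
    have "2 * of_nat k + \<nu> + 1 - 1 + (2 - \<nu>) = 2 * of_nat (Suc k)"
      by simp
    then show ?thesis
      unfolding e by (simp add: p_def)
  qed
  ultimately have L: "(\<lambda>k. of_nat (Suc k) * \<alpha> (Suc k) * (2 * of_nat k + \<nu> + 1) * p k) sums L"
    by (simp only:)
  have "(\<lambda>k. \<beta> k * (2 * of_nat k + (\<nu> + 1)) * (2 * of_nat k + (\<nu> + 1) - 1 + (\<nu> + 2)) / 2 *
            (z / 2) powr (2 * of_nat k + (\<nu> + 1) - 1)) sums R"
    unfolding R_def B_def unified_Bessel_eq_half_powr_series \<beta>_def
    by (rule half_powr_series_second_order_sums[OF summable_Bessel_coeff[OF assms(2)] assms(3)])
  moreover have "\<beta> k * (2 * of_nat k + (\<nu> + 1)) * (2 * of_nat k + (\<nu> + 1) - 1 + (\<nu> + 2)) / 2 *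
            (z / 2) powr (2 * of_nat k + (\<nu> + 1) - 1) =
       (\<nu> + of_nat k + 1) * \<beta> k * (2 * of_nat k + \<nu> + 1) * p k" for k
    by (simp add: p_def field_simps)
  ultimately have "(\<lambda>k. (\<nu> + of_nat k + 1) * \<beta> k * (2 * of_nat k + \<nu> + 1) * p k) sums R"
    by (simp only:)
  then have "(\<lambda>k. - b * ((\<nu> + of_nat k + 1) * \<beta> k * (2 * of_nat k + \<nu> + 1) * p k)) sums (- b * R)"
    by (rule sums_mult)
  moreover have "- b * ((\<nu> + of_nat k + 1) * \<beta> k * (2 * of_nat k + \<nu> + 1) * p k) =
      of_nat (Suc k) * \<alpha> (Suc k) * (2 * of_nat k + \<nu> + 1) * p k" for k
    unfolding \<alpha>_def \<beta>_def Bessel_coeff_contiguous by (simp only: mult_ac)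
  ultimately have "L = - b * R"
    using L sums_unique2 by simp
  then show ?thesis
    unfolding L_def R_def A_def[symmetric] B_def[symmetric] by (simp add: algebra_simps)
qed

end
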